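(* Consider the sim-to-real betting procedure (described in the context) with $K\ge2$ simulators with moments $(\mu_k,\sigma_k^2)$, learning rate $\eta>0$, $\kappa\in(0,1]$, $\delta\in(0,1)$, horizon $T$, run on i.i.d. real observations with mean $\mu^*$ and variance $\sigma^2$. Fix a reference simulator $k'\in\{1,\dots,K\}$. For $k\ne k'$ let $r_t^k=\pi_t^k/\pi_t^{k'}$ and $G_t^k=r_{t+1}^k/r_t^k$, and suppose that for some $\rho\in(0,1)$, $$\mathbb{E}\big[G_t^k\big]\le\rho\qquad\text{for all }k\in\{1,\dots,K\}\setminus\{k'\}\text{ and all }t\in\{1,\dots,T-1\}.$$ Let $$v_{\min}=\min\{\sigma^2,\sigma_1^2,\dots,\sigma_K^2\},\qquad a_m=\frac{\kappa}{\delta v_{\min}},\qquad a_v=\frac{9\kappa}{16\sqrt3\,\delta v_{\min}^{3/2}},$$ $$h_m=|\mu_{k'}-\mu^*|,\quad h_v=|\sigma_{k'}^2-\sigma^2|,\quad D_m=\max_{1\le k\le K}|\mu_k-\mu_{k'}|,\quad D_v=\max_{1\le k\le K}|\sigma_k^2-\sigma_{k'}^2|.$$ Then for every $t\in\{1,\dots,T\}$, $$S_t:=\sum_{\tau=1}^t\min\{1,(K-1)\rho^{\tau-1}\}\ \le\ 1+\left[\frac{\log(K-1)}{-\log\rho}\right]+\frac{1}{1-\rho},$$ where the square brackets denote ordinary grouping, and the worst-candidate positive wealth regret $\overline{\mathcal{R}}_t$ satisfies $$\frac{\mathbb{E}\big[\overline{\mathcal{R}}_t\big]}{t}\ \le\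 a_m\Big(h_m+D_m\frac{S_t}{t}\Big)+a_v\Big(h_v+D_v\frac{S_t}{t}\Big),$$ where the expectation is over the i.i.d. real stream from $P$.
   Context: Real data: $P$ is a probability distribution on a measurable space $\mathcal{X}$, $\psi:\mathcal{X}\to[0,1]$ is measurable, $x_1,x_2,\dots$ are i.i.d. from $P$, $y_t=\psi(x_t)$, $\mu^*=\mathbb{E}[y_t]$, $\sigma^2=\mathbb{E}[(y_t-\mu^* )^2]>0$. Candidate means are $\mu\in\mathcal{M}=[0,1]$. Simulator bank: $K$ fixed (deterministic) pairs $(\mu_k,\sigma_k^2)$, with $\mu_k\in[0,1]$ and $\sigma_k^2>0$. Clipping: for a candidate $\mu$, $\mathrm{clip}_\delta$ truncates a real number to $\big[-\tfrac{1-\delta}{1-\mu},\tfrac{1-\delta}{\mu}\big]$ (an endpoint with zero denominator is read as $-\infty$, respectively $+\infty$). Sim-to-real betting procedure: $L_0^k=0$, $M_0(\mu)=1$. For $t=1,\dots,T$: $$\pi_t^k=\frac{\exp(\eta L_{t-1}^k)}{\sum_{j=1}^K\exp(\eta L_{t-1}^j)},\quad m_t=\sum_{k=1}^K\pi_t^k\mu_k,\quad v_t=\sum_{k=1}^K\pi_t^k\sigma_k^2,\quad \lambda_t(\mu)=\mathrm{clip}_\delta\Big\{\frac{\kappa(m_t-\mu)}{v_t+(m_t-\mu)^2}\Big\};$$ then $y_t$ is observed and $$M_t(\mu)=M_{t-1}(\mu)[1+\lambda_t(\mu)(y_t-\mu)],\qquad L_t^k=L_{t-1}^k+\log\mathcal{N}(y_t;\mu_k,\sigma_k^2),$$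 where $\mathcal{N}(y;m,v)=(2\pi v)^{-1/2}\exp(-(y-m)^2/(2v))$. Ideal Kelly benchmark (same $\kappa,\delta$, same observations): $\lambda^*(\mu)=\mathrm{clip}_\delta\Big\{\frac{\kappa(\mu^*-\mu)}{\sigma^2+(\mu^*-\mu)^2}\Big\}$, $M_0^*(\mu)=1$, $M_t^*(\mu)=M_{t-1}^*(\mu)[1+\lambda^*(\mu)(y_t-\mu)]$. Wealth regret: $\mathcal{R}_t(\mu)=\log M_t^*(\mu)-\log M_t(\mu)$, $\mathcal{R}_t^+(\mu)=\max\{\mathcal{R}_t(\mu),0\}$, $\overline{\mathcal{R}}_t=\sup_{\mu\in\mathcal{M}}\mathcal{R}_t^+(\mu)$. *)

theory Defs
  imports "HOL-Probability.Probability"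
begin

text \<open>
  The procedure is a deterministic function of the observation path \<open>y\<close> (\<open>y t\<close> is used for
  \<open>t \<ge> 1\<close> only) and of the bank \<open>mu k\<close>, \<open>s2 k\<close> of means and variances, \<open>k \<in> {1..K}\<close>.
  Randomness enters when \<open>y\<close> is a sample path.
\<close>

text \<open>
  A zero denominator (\<open>m = 0\<close> on the right, \<open>m = 1\<close> on the left) means that there is no
  truncation on that side; the default \<open>x / 0 = 0\<close> would be wrong here.
\<close>
definition clip :: "real \<Rightarrow> real \<Rightarrow> real \<Rightarrow> real" where
  "clip \<delta> m z =
     (let u = (if m = 0 then z else min z ((1 - \<delta>) / m))
      in if m = 1 then u else max u (- ((1 - \<delta>) / (1 - m))))"

definition kelly_bet :: "real \<Rightarrow> real \<Rightarrow> real \<Rightarrow> real \<Rightarrow> real \<Rightarrow> real" where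
  "kelly_bet \<kappa> \<delta> mean var m = clip \<delta> m (\<kappa> * (mean - m) / (var + (mean - m)\<^sup>2))"

text \<open>\<open>normal_density\<close> takes the standard deviation as its second argument.\<close>
primrec cum_loglik :: "(nat \<Rightarrow> real) \<Rightarrow> (nat \<Rightarrow> real) \<Rightarrow> (nat \<Rightarrow> real) \<Rightarrow> nat \<Rightarrow> nat \<Rightarrow> real" where
  "cum_loglik mu s2 y k 0 = 0"
| "cum_loglik mu s2 y k (Suc t) =
     cum_loglik mu s2 y k t + ln (normal_density (mu k) (sqrt (s2 k)) (y (Suc t)))"

text \<open>\<open>sim_weight\<close> and everything built from it are meaningful for \<open>t \<ge> 1\<close>.\<close>
definition sim_weight ::
  "real \<Rightarrow> nat \<Rightarrow> (nat \<Rightarrow> real) \<Rightarrow> (nat \<Rightarrow> real) \<Rightarrow> (nat \<Rightarrow> real) \<Rightarrow> nat \<Rightarrow> nat \<Rightarrow> real" where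
  "sim_weight \<eta> K mu s2 y k t =
     exp (\<eta> * cum_loglik mu s2 y k (t - 1)) /
     (\<Sum>j=1..K. exp (\<eta> * cum_loglik mu s2 y j (t - 1)))"

definition mix_mean ::
  "real \<Rightarrow> nat \<Rightarrow> (nat \<Rightarrow> real) \<Rightarrow> (nat \<Rightarrow> real) \<Rightarrow> (nat \<Rightarrow> real) \<Rightarrow> nat \<Rightarrow> real" where
  "mix_mean \<eta> K mu s2 y t = (\<Sum>k=1..K. sim_weight \<eta> K mu s2 y k t * mu k)"

definition mix_var ::
  "real \<Rightarrow> nat \<Rightarrow> (nat \<Rightarrow> real) \<Rightarrow> (nat \<Rightarrow> real) \<Rightarrow> (nat \<Rightarrow> real) \<Rightarrow> nat \<Rightarrow> real" where
  "mix_var \<eta> K mu s2 y t = (\<Sum>k=1..K. sim_weight \<eta> K mu s2 y k t * s2 k)"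

primrec wealth :: "(nat \<Rightarrow> real) \<Rightarrow> (nat \<Rightarrow> real) \<Rightarrow> real \<Rightarrow> nat \<Rightarrow> real" where
  "wealth bet y m 0 = 1"
| "wealth bet y m (Suc t) = wealth bet y m t * (1 + bet (Suc t) * (y (Suc t) - m))"

definition sim_wealth ::
  "real \<Rightarrow> real \<Rightarrow> real \<Rightarrow> nat \<Rightarrow> (nat \<Rightarrow> real) \<Rightarrow> (nat \<Rightarrow> real) \<Rightarrow> (nat \<Rightarrow> real) \<Rightarrow> real \<Rightarrow> nat \<Rightarrow> real"
where
  "sim_wealth \<eta> \<kappa> \<delta> K mu s2 y m =
     wealth (\<lambda>t. kelly_bet \<kappa> \<delta> (mix_mean \<eta> K mu s2 y t) (mix_var \<eta> K mu s2 y t) m) y m"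

definition ideal_wealth ::
  "real \<Rightarrow> real \<Rightarrow> real \<Rightarrow> real \<Rightarrow> (nat \<Rightarrow> real) \<Rightarrow> real \<Rightarrow> nat \<Rightarrow> real" where
  "ideal_wealth \<kappa> \<delta> mean var y m = wealth (\<lambda>_. kelly_bet \<kappa> \<delta> mean var m) y m"

text \<open>\<open>mu0\<close> and \<open>var0\<close> are the true mean and variance used by the ideal benchmark.\<close>
definition wealth_regret ::
  "real \<Rightarrow> real \<Rightarrow> real \<Rightarrow> nat \<Rightarrow> (nat \<Rightarrow> real) \<Rightarrow> (nat \<Rightarrow> real) \<Rightarrow> real \<Rightarrow> real \<Rightarrow>
   (nat \<Rightarrow> real) \<Rightarrow> real \<Rightarrow> nat \<Rightarrow> real"
where
  "wealth_regret \<eta> \<kappa> \<delta> K mu s2 mu0 var0 y m t =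
     ln (ideal_wealth \<kappa> \<delta> mu0 var0 y m t) - ln (sim_wealth \<eta> \<kappa> \<delta> K mu s2 y m t)"

definition worst_regret ::
  "real \<Rightarrow> real \<Rightarrow> real \<Rightarrow> nat \<Rightarrow> (nat \<Rightarrow> real) \<Rightarrow> (nat \<Rightarrow> real) \<Rightarrow> real \<Rightarrow> real \<Rightarrow>
   (nat \<Rightarrow> real) \<Rightarrow> nat \<Rightarrow> real"
where
  "worst_regret \<eta> \<kappa> \<delta> K mu s2 mu0 var0 y t =
     (SUP m\<in>{0..1}. max (wealth_regret \<eta> \<kappa> \<delta> K mu s2 mu0 var0 y m t) 0)"

definition weight_ratio ::
  "real \<Rightarrow> nat \<Rightarrow> (nat \<Rightarrow> real) \<Rightarrow> (nat \<Rightarrow> real) \<Rightarrow> nat \<Rightarrow> (nat \<Rightarrow> real) \<Rightarrow> nat \<Rightarrow> nat \<Rightarrow> real" where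
  "weight_ratio \<eta> K mu s2 k' y k t = sim_weight \<eta> K mu s2 y k t / sim_weight \<eta> K mu s2 y k' t"

definition ratio_growth ::
  "real \<Rightarrow> nat \<Rightarrow> (nat \<Rightarrow> real) \<Rightarrow> (nat \<Rightarrow> real) \<Rightarrow> nat \<Rightarrow> (nat \<Rightarrow> real) \<Rightarrow> nat \<Rightarrow> nat \<Rightarrow> real" where
  "ratio_growth \<eta> K mu s2 k' y k t =
     weight_ratio \<eta> K mu s2 k' y k (t + 1) / weight_ratio \<eta> K mu s2 k' y k t"

end

theory Submission imports Defs begin

text \<open>
  Clipping is 1-Lipschitz and keeps every wealth factor above \<open>\<delta>\<close>, so each round costs at most
  \<open>1 / \<delta>\<close> times the distance between the ideal and the actual Kelly fractions, uniformly in the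
  candidate. The Kelly fraction is Lipschitz in mean and variance, which bounds the regret by the
  errors of the mixture moments, and these exceed the errors of \<open>k'\<close> by at most \<open>D (1 - \<pi>)\<close>, where
  \<open>\<pi>\<close> is the weight of \<open>k'\<close>. Finally \<open>1 - \<pi>\<close> is at most the sum of the weight ratios against \<open>k'\<close>;
  each ratio is a product of independent likelihood ratios, hence has mean at most \<open>\<rho> ^ (t - 1)\<close>.
\<close>

section \<open>Clipping: Lipschitz dependence on the bet and a floor for the wealth factors\<close>

lemma clip_Lipschitz: "\<bar>clip \<delta> m a - clip \<delta> m b\<bar> \<le> \<bar>a - b\<bar>"
  unfolding clip_def Let_def by (auto split: if_splits simp: min_def max_def)

text \<open>The factor is affine in \<open>y\<close>, so a nonnegative bet is worst at
  \<open>y = 0\<close>, where the right end of the clipping range gives \<delta>, and a negative bet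
  is worst at \<open>y = 1\<close>, where the left end does. If the relevant end is absent
  (\<open>m = 0\<close> or \<open>m = 1\<close>), the gain itself is nonnegative.\<close>

lemma clipped_factor_ge:
  assumes "\<delta> \<in> {0<..<1}" "m \<in> {0..1}" "y \<in> {0..1}"
  shows "1 + clip \<delta> m z * (y - m) \<ge> \<delta>"
proof (cases "clip \<delta> m z \<ge> 0")
  case True
  show ?thesis
  proof (cases "m = 0")
    case True
    with \<open>clip \<delta> m z \<ge> 0\<close> assms have "0 \<le> clip \<delta> m z * (y - m)" by auto
    with assms show ?thesis by auto
  next
    case False
    with assms have "m > 0" by auto
    \<comment> \<open>\<open>clip\<close> applies the left end last; the two ends are in order, so
      this cannot push the value above the right end. For \<open>m = 1\<close> the division default
      0 is harmless.\<close>
    have lower: "- ((1 - \<delta>) / (1 - m)) \<le> (1 - \<delta>) / m"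
    proof -
      have "0 \<le> (1 - \<delta>) / m" "0 \<le> (1 - \<delta>) / (1 - m)" using assms by auto
      then show ?thesis by linarith
    qed
    with \<open>m > 0\<close> have "clip \<delta> m z \<le> (1 - \<delta>) / m"
      by (auto simp: clip_def Let_def)
    with \<open>m > 0\<close> have "clip \<delta> m z * m \<le> 1 - \<delta>"
      by (simp add: field_simps)
    moreover have "0 \<le> clip \<delta> m z * y" using True assms by auto
    ultimately show ?thesis by (simp add: algebra_simps)
  qed
next
  case False
  show ?thesis
  proof (cases "m = 1")
    case True
    with False assms have "0 \<le> clip \<delta> m z * (y - m)" by (auto intro: mult_nonpos_nonpos)
    with assms show ?thesis by auto
  next
    case m1: False
    with assms have "m < 1" by auto
    with m1 have "- ((1 - \<delta>) / (1 - m)) \<le> clip \<delta> m z"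
      by (simp add: clip_def Let_def)
    with \<open>m < 1\<close> have "- (1 - \<delta>) \<le> clip \<delta> m z * (1 - m)"
      by (simp add: field_simps)
    moreover have "0 \<le> clip \<delta> m z * (y - 1)"
      using False assms by (auto intro: mult_nonpos_nonpos)
    moreover have "clip \<delta> m z * (y - m) = clip \<delta> m z * (y - 1) + clip \<delta> m z * (1 - m)"
      by (simp add: algebra_simps)
    ultimately show ?thesis by linarith
  qed
qed

section \<open>Lipschitz constants of the Kelly fraction in mean and variance\<close>

lemma frac_le_frac:
  fixes p q x r :: real
  assumes "p > 0" "q > 0" "p * x \<le> r * q"
  shows "x / q \<le> r / p"
  using assms by (simp add: field_simps)

text \<open>The difference quotient is
  \<open>(v - d * e) / ((v + d\<^sup>2) * (v + e\<^sup>2))\<close>. Since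
  \<open>2 * \<bar>d * e\<bar> \<le> d\<^sup>2 + e\<^sup>2\<close>, its numerator times
  \<open>v\<close> is dominated by its denominator.\<close>

lemma kelly_Lipschitz_mean:
  fixes d e v :: real
  assumes "v > 0"
  shows "\<bar>d / (v + d\<^sup>2) - e / (v + e\<^sup>2)\<bar> \<le> \<bar>d - e\<bar> / v"
proof -
  have pos: "v + d\<^sup>2 > 0" "v + e\<^sup>2 > 0"
    using assms by (simp_all add: add_pos_nonneg)
  have eq: "d / (v + d\<^sup>2) - e / (v + e\<^sup>2) = (d - e) * ((v - d * e) / ((v + d\<^sup>2) * (v + e\<^sup>2)))"
    using pos by (simp add: field_simps power2_eq_square)
  have "v * (2 * \<bar>d * e\<bar>) \<le> v * (d\<^sup>2 + e\<^sup>2)"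
    using assms sum_squares_bound[of "\<bar>d\<bar>" "\<bar>e\<bar>"]
    by (intro mult_left_mono) (auto simp: abs_mult mult.assoc)
  moreover have "v * \<bar>v - d * e\<bar> \<le> v * (v + 2 * \<bar>d * e\<bar>)"
    using assms by (intro mult_left_mono) auto
  moreover have "0 \<le> d\<^sup>2 * e\<^sup>2" by simp
  ultimately have "v * \<bar>v - d * e\<bar> \<le> (v + d\<^sup>2) * (v + e\<^sup>2)"
    by (simp add: algebra_simps power2_eq_square)
  then have "\<bar>v - d * e\<bar> / ((v + d\<^sup>2) * (v + e\<^sup>2)) \<le> 1 / v"
    using frac_le_frac[of v "(v + d\<^sup>2) * (v + e\<^sup>2)" "\<bar>v - d * e\<bar>" 1] pos assms by simp
  then have "\<bar>(v - d * e) / ((v + d\<^sup>2) * (v + e\<^sup>2))\<bar> \<le> 1 / v"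
    using pos by (simp add: abs_mult)
  from mult_left_mono[OF this, of "\<bar>d - e\<bar>"] show ?thesis
    unfolding eq abs_mult by simp
qed

text \<open>The extremal case of the inequality is \<open>d\<^sup>2 = c / 3\<close>.\<close>

lemma square_sum_ge:
  fixes c d :: real
  assumes "c > 0" "d \<ge> 0"
  shows "16 * sqrt 3 * c powr (3 / 2) * d \<le> 9 * (c + d\<^sup>2)\<^sup>2"
proof -
  define s where "s = sqrt (c / 3)"
  have s: "s > 0" "c = 3 * s\<^sup>2" using assms by (auto simp: s_def)
  have "c powr (3 / 2) = sqrt c * c"
    using assms powr_add[of c "1 / 2" 1] by (simp add: powr_half_sqrt)
  also have "sqrt c = sqrt 3 * s" using assms by (simp add: s_def real_sqrt_divide)
  finally have "sqrt 3 * c powr (3 / 2) = 9 * s ^ 3"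
    using s by (simp add: power2_eq_square power3_eq_cube)
  \<comment> \<open>As a polynomial in \<open>d\<close> the difference has a double root at the
    extremal point \<open>s\<close>; the remaining factor has only nonnegative terms.\<close>
  moreover have "(3 * s\<^sup>2 + d\<^sup>2)\<^sup>2 - 16 * s ^ 3 * d = (d - s)\<^sup>2 * (d\<^sup>2 + 2 * s * d + 9 * s\<^sup>2)"
    by algebra
  moreover have "0 \<le> (d - s)\<^sup>2 * (d\<^sup>2 + 2 * s * d + 9 * s\<^sup>2)"
    using s assms by (intro mult_nonneg_nonneg add_nonneg_nonneg) auto
  ultimately have "16 * s ^ 3 * d \<le> (c + d\<^sup>2)\<^sup>2" "sqrt 3 * c powr (3 / 2) = 9 * s ^ 3"
    using s by auto
  moreover from this(1) have "16 * (9 * s ^ 3) * d \<le> 9 * (c + d\<^sup>2)\<^sup>2" by linarith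
  ultimately have "16 * (sqrt 3 * c powr (3 / 2)) * d \<le> 9 * (c + d\<^sup>2)\<^sup>2" by (simp only:)
  then show ?thesis by (simp only: mult.assoc)
qed

text \<open>The difference quotient is
  \<open>\<bar>d\<bar> / ((v + d\<^sup>2) * (w + d\<^sup>2))\<close>, which is at most
  \<open>\<bar>d\<bar> / (c + d\<^sup>2)\<^sup>2\<close>. The constant is the maximum of the latter
  over \<open>d\<close>, by \<open>square_sum_ge\<close>.\<close>

lemma kelly_Lipschitz_var:
  fixes d v w c :: real
  assumes "c > 0" "v \<ge> c" "w \<ge> c"
  shows "\<bar>d / (v + d\<^sup>2) - d / (w + d\<^sup>2)\<bar> \<le> 9 / (16 * sqrt 3 * c powr (3 / 2)) * \<bar>v - w\<bar>"
proof -
  have pos: "c + d\<^sup>2 > 0" "v + d\<^sup>2 > 0" "w + d\<^sup>2 > 0"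
    using assms by (auto intro!: add_pos_nonneg)
  have "d / (v + d\<^sup>2) - d / (w + d\<^sup>2) = d * (w - v) / ((v + d\<^sup>2) * (w + d\<^sup>2))"
    using pos by (simp add: field_simps)
  then have eq: "\<bar>d / (v + d\<^sup>2) - d / (w + d\<^sup>2)\<bar> = \<bar>d\<bar> / ((v + d\<^sup>2) * (w + d\<^sup>2)) * \<bar>v - w\<bar>"
    using pos by (simp add: abs_mult abs_minus_commute)
  have "16 * sqrt 3 * c powr (3 / 2) * \<bar>d\<bar> \<le> 9 * (c + d\<^sup>2)\<^sup>2"
    using square_sum_ge[of c "\<bar>d\<bar>"] assms by simp
  also have "\<dots> \<le> 9 * ((v + d\<^sup>2) * (w + d\<^sup>2))"
    unfolding power2_eq_square[of "c + d\<^sup>2"] using pos assms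
    by (intro mult_left_mono mult_mono) auto
  finally have "\<bar>d\<bar> / ((v + d\<^sup>2) * (w + d\<^sup>2)) \<le> 9 / (16 * sqrt 3 * c powr (3 / 2))"
    using frac_le_frac[of "16 * sqrt 3 * c powr (3 / 2)" "(v + d\<^sup>2) * (w + d\<^sup>2)" "\<bar>d\<bar>" 9] pos assms
    by simp
  then show ?thesis unfolding eq by (rule mult_right_mono) simp
qed

text \<open>One argument is changed at a time: first the mean at fixed variance \<open>v\<close>,
  then the variance at fixed mean \<open>b\<close>. With \<open>c = v_min\<close> the two
  coefficients are \<open>a_m\<close> and \<open>a_v\<close> without their factor
  \<open>1 / \<delta>\<close>.\<close>

lemma kelly_bet_diff:
  assumes "\<kappa> > 0" "c > 0" "v \<ge> c" "w \<ge> c"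
  shows "\<bar>kelly_bet \<kappa> \<delta> a v m - kelly_bet \<kappa> \<delta> b w m\<bar>
    \<le> \<kappa> / c * \<bar>a - b\<bar> + 9 * \<kappa> / (16 * sqrt 3 * c powr (3 / 2)) * \<bar>v - w\<bar>"
proof -
  let ?f = "\<lambda>a v. (a - m) / (v + (a - m)\<^sup>2)"
  have "\<bar>?f a v - ?f b w\<bar> \<le> \<bar>?f a v - ?f b v\<bar> + \<bar>?f b v - ?f b w\<bar>" by linarith
  also have "\<dots> \<le> \<bar>a - b\<bar> / v + 9 / (16 * sqrt 3 * c powr (3 / 2)) * \<bar>v - w\<bar>"
    using kelly_Lipschitz_mean[of v "a - m" "b - m"] kelly_Lipschitz_var[of c v w "b - m"] assms
    by (intro add_mono) auto
  also have "\<dots> \<le> \<bar>a - b\<bar> / c + 9 / (16 * sqrt 3 * c powr (3 / 2)) * \<bar>v - w\<bar>"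
    using assms by (intro add_mono divide_left_mono) auto
  finally have "\<kappa> * \<bar>?f a v - ?f b w\<bar> \<le>
      \<kappa> * (\<bar>a - b\<bar> / c + 9 / (16 * sqrt 3 * c powr (3 / 2)) * \<bar>v - w\<bar>)"
    using assms by (intro mult_left_mono) auto
  moreover have "\<kappa> * \<bar>?f a v - ?f b w\<bar> = \<bar>\<kappa> * (a - m) / (v + (a - m)\<^sup>2) - \<kappa> * (b - m) / (w + (b - m)\<^sup>2)\<bar>"
  proof -
    have "\<kappa> * (a - m) / (v + (a - m)\<^sup>2) - \<kappa> * (b - m) / (w + (b - m)\<^sup>2) = \<kappa> * (?f a v - ?f b w)"
      by (simp add: right_diff_distrib)
    then show ?thesis using assms by (simp only: abs_mult abs_of_pos)
  qed
  ultimately show ?thesis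
    using clip_Lipschitz[of \<delta> m "\<kappa> * (a - m) / (v + (a - m)\<^sup>2)" "\<kappa> * (b - m) / (w + (b - m)\<^sup>2)"]
    unfolding kelly_bet_def by (simp add: algebra_simps)
qed

section \<open>Logarithmic wealth of two bettors on the same path\<close>

lemma ln_Lipschitz:
  fixes a b \<delta> :: real
  assumes "\<delta> > 0" "a \<ge> \<delta>" "b \<ge> \<delta>"
  shows "ln a - ln b \<le> \<bar>a - b\<bar> / \<delta>"
proof -
  have "ln a - ln b \<le> (a - b) / b" using ln_diff_le[of a b] assms by simp
  also have "\<dots> \<le> \<bar>a - b\<bar> / b" using assms by (intro divide_right_mono) auto
  also have "\<dots> \<le> \<bar>a - b\<bar> / \<delta>" using assms by (intro divide_left_mono) auto
  finally show ?thesis .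
qed

lemma wealth_pos:
  assumes "\<And>s. s \<in> {1..t} \<Longrightarrow> 1 + b s * (y s - m) > 0"
  shows "wealth b y m t > 0"
  using assms by (induction t) auto

text \<open>Log wealth adds up over rounds. In each round both factors are at least \<delta>, where
  the logarithm is \<open>1 / \<delta>\<close>-Lipschitz, and
  \<open>\<bar>y s - m\<bar> \<le> 1\<close> removes the candidate from the difference of the
  factors.\<close>

lemma ln_wealth_diff_le:
  assumes "\<delta> > 0" "\<And>s. s \<in> {1..t} \<Longrightarrow> \<bar>y s - m\<bar> \<le> 1"
    "\<And>s. s \<in> {1..t} \<Longrightarrow> 1 + b s * (y s - m) \<ge> \<delta>"
    "\<And>s. s \<in> {1..t} \<Longrightarrow> 1 + c s * (y s - m) \<ge> \<delta>"
  shows "ln (wealth b y m t) - ln (wealth c y m t) \<le> (\<Sum>s=1..t. \<bar>b s - c s\<bar> / \<delta>)"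
  using assms(2-)
proof (induction t)
  case 0
  then show ?case by simp
next
  case (Suc t)
  have pos: "wealth b y m t > 0" "wealth c y m t > 0"
    using Suc.prems \<open>\<delta> > 0\<close> by (auto intro!: wealth_pos intro: less_le_trans)
  have fac: "1 + b (Suc t) * (y (Suc t) - m) \<ge> \<delta>" "1 + c (Suc t) * (y (Suc t) - m) \<ge> \<delta>"
    "\<bar>y (Suc t) - m\<bar> \<le> 1"
    using Suc.prems by auto
  have "ln (1 + b (Suc t) * (y (Suc t) - m)) - ln (1 + c (Suc t) * (y (Suc t) - m))
      \<le> \<bar>(b (Suc t) - c (Suc t)) * (y (Suc t) - m)\<bar> / \<delta>"
    using ln_Lipschitz[OF \<open>\<delta> > 0\<close> fac(1,2)] by (simp add: algebra_simps)
  also have "\<dots> \<le> \<bar>b (Suc t) - c (Suc t)\<bar> / \<delta>"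
    using fac \<open>\<delta> > 0\<close> by (intro divide_right_mono) (auto simp: abs_mult intro: mult_left_le)
  finally have "ln (1 + b (Suc t) * (y (Suc t) - m)) - ln (1 + c (Suc t) * (y (Suc t) - m))
      \<le> \<bar>b (Suc t) - c (Suc t)\<bar> / \<delta>" .
  moreover have "ln (wealth b y m t) - ln (wealth c y m t) \<le> (\<Sum>s=1..t. \<bar>b s - c s\<bar> / \<delta>)"
    using Suc.prems by (intro Suc.IH) auto
  ultimately show ?case using pos fac \<open>\<delta> > 0\<close> by (simp add: ln_mult)
qed

section \<open>Continuity in the candidate and measurability of suprema over candidates\<close>

lemma continuous_on_kelly_bet:
  assumes "\<kappa> > 0" "\<delta> < 1" "v > 0"
  shows "continuous_on {0..1} (kelly_bet \<kappa> \<delta> a v)"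
proof -
  let ?z = "\<lambda>m. \<kappa> * (a - m) / (v + (a - m)\<^sup>2)"
  text \<open>
    The unclipped bet is at most \<open>B\<close> in absolute value, so truncating the denominators \<open>m\<close> and \<open>1 - m\<close>
    from below at \<open>\<epsilon>\<close> changes nothing and removes the singular endpoints.
  \<close>
  define B where "B = \<kappa> * (\<bar>a\<bar> + 1) / v"
  define \<epsilon> where "\<epsilon> = (1 - \<delta>) / B"
  have "B > 0" using assms by (auto simp: B_def intro!: divide_pos_pos mult_pos_pos)
  with assms have eps: "\<epsilon> > 0" "(1 - \<delta>) / \<epsilon> = B" by (auto simp: \<epsilon>_def)
  have "v + (a - m)\<^sup>2 \<noteq> 0" for m
    using assms by (metis add_pos_nonneg less_irrefl zero_le_power2)
  moreover have "max m \<epsilon> \<noteq> 0" for m using eps by auto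
  ultimately have cont: "continuous_on {0..1}
      (\<lambda>m. max (min (?z m) ((1 - \<delta>) / max m \<epsilon>)) (- ((1 - \<delta>) / max (1 - m) \<epsilon>)))"
    by (intro continuous_intros) auto
  have bound: "\<bar>?z m\<bar> \<le> B" if "m \<in> {0..1}" for m
  proof -
    have "\<bar>?z m\<bar> = \<kappa> * \<bar>a - m\<bar> / (v + (a - m)\<^sup>2)"
      using assms by (simp add: abs_mult add_nonneg_nonneg)
    also have "\<dots> \<le> \<kappa> * (\<bar>a\<bar> + 1) / v"
      using assms that by (intro frac_le mult_left_mono mult_nonneg_nonneg) auto
    finally show ?thesis by (simp add: B_def)
  qed
  have trunc: "B \<le> (1 - \<delta>) / p" if "0 < p" "p \<le> \<epsilon>" for p
    using that eps assms unfolding eps(2)[symmetric] by (intro divide_left_mono) auto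
  have "kelly_bet \<kappa> \<delta> a v m =
      max (min (?z m) ((1 - \<delta>) / max m \<epsilon>)) (- ((1 - \<delta>) / max (1 - m) \<epsilon>))"
    if "m \<in> {0..1}" for m
  proof -
    have "(if m = 0 then ?z m else min (?z m) ((1 - \<delta>) / m)) = min (?z m) ((1 - \<delta>) / max m \<epsilon>)"
    proof (cases "m \<le> \<epsilon>")
      case True
      have "?z m \<le> B" using bound[OF that] by (rule abs_le_D1)
      moreover have "m \<noteq> 0 \<Longrightarrow> B \<le> (1 - \<delta>) / m" using trunc[of m] True that by auto
      moreover have "(1 - \<delta>) / max m \<epsilon> = B" using True eps by (simp add: max_absorb2)
      ultimately show ?thesis by (auto simp: min_absorb1)
    next
      case False
      with eps show ?thesis by (simp add: max_absorb1)
    qed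
    moreover have "(if m = 1 then u else max u (- ((1 - \<delta>) / (1 - m)))) =
        max u (- ((1 - \<delta>) / max (1 - m) \<epsilon>))"
      if "u = min (?z m) ((1 - \<delta>) / max m \<epsilon>)" for u
    proof -
      \<comment> \<open>Truncation from above happens at a nonnegative level, so \<open>u\<close>
        inherits the lower bound \<open>- B\<close> from the unclipped bet, and the truncation from
        below has no effect near \<open>m = 1\<close>.\<close>
      have "0 \<le> (1 - \<delta>) / max m \<epsilon>" using assms eps by auto
      moreover have "- B \<le> ?z m" using bound[OF \<open>m \<in> {0..1}\<close>] by linarith
      ultimately have "- B \<le> u" using that \<open>B > 0\<close> by auto
      show ?thesis
      proof (cases "1 - m \<le> \<epsilon>")
        case True
        moreover have "m \<noteq> 1 \<Longrightarrow> B \<le> (1 - \<delta>) / (1 - m)"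
          using trunc[of "1 - m"] True \<open>m \<in> {0..1}\<close> by auto
        moreover have "(1 - \<delta>) / max (1 - m) \<epsilon> = B" using True eps by (simp add: max_absorb2)
        ultimately show ?thesis using \<open>- B \<le> u\<close> by (auto simp: max_def)
      next
        case False
        with eps show ?thesis by (simp add: max_absorb1)
      qed
    qed
    ultimately show ?thesis by (simp add: kelly_bet_def clip_def Let_def)
  qed
  then show ?thesis by (intro continuous_on_eq[OF cont]) simp
qed

text \<open>Used to replace the uncountable supremum over \<open>{0..1}\<close> by one over a
  countable dense set.\<close>

lemma SUP_closure_eq:
  fixes f :: "'a :: metric_space \<Rightarrow> real"
  assumes "continuous_on (closure A) f" "compact (closure A)" "A \<noteq> {}"
  shows "(SUP x\<in>closure A. f x) = (SUP x\<in>A. f x)"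
proof (rule antisym)
  have bdd: "bdd_above (f ` closure A)"
    using assms by (intro bounded_imp_bdd_above compact_imp_bounded compact_continuous_image)
  then have bdd': "bdd_above (f ` A)"
    by (rule bdd_above_mono) (use closure_subset in auto)
  show "(SUP x\<in>closure A. f x) \<le> (SUP x\<in>A. f x)"
  proof (rule cSUP_least)
    show "closure A \<noteq> {}" using assms by simp
    show "f x \<le> (SUP x\<in>A. f x)" if "x \<in> closure A" for x
      using assms(1) that by (rule continuous_le_on_closure) (auto intro: cSUP_upper bdd')
  qed
  show "(SUP x\<in>A. f x) \<le> (SUP x\<in>closure A. f x)"
    using assms(3) bdd closure_subset by (intro cSUP_subset_mono) auto
qed

text \<open>Intersecting with an open set preserves density, hence the open interval on the
  left.\<close>

lemma closure_rational_unit_interval: "closure ({0<..<1} \<inter> \<rat>) = {0..1::real}"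
  by (subst closure_open_Int_superset) (auto simp: Rats_closure_real)

text \<open>Uncountable suprema need not preserve measurability; continuity in \<open>m\<close>
  reduces this one to rational \<open>m\<close>.\<close>

lemma borel_measurable_SUP_unit_interval:
  fixes f :: "'a \<Rightarrow> real \<Rightarrow> real"
  assumes "\<And>m. m \<in> {0..1} \<Longrightarrow> (\<lambda>\<omega>. f \<omega> m) \<in> borel_measurable M"
    and cont: "\<And>\<omega>. \<omega> \<in> space M \<Longrightarrow> continuous_on {0..1} (f \<omega>)"
  shows "(\<lambda>\<omega>. SUP m\<in>{0..1}. f \<omega> m) \<in> borel_measurable M"
proof -
  let ?A = "{0<..<1} \<inter> \<rat> :: real set"
  have ne: "?A \<noteq> {}" using closure_rational_unit_interval by (metis atLeastatMost_empty_iff2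
    closure_empty zero_le_one)
  have "(\<lambda>\<omega>. SUP m\<in>?A. f \<omega> m) \<in> borel_measurable M"
  proof (rule borel_measurable_cSUP)
    show "countable ?A" using countable_rat by blast
    show "bdd_above ((\<lambda>m. f \<omega> m) ` ?A)" if "\<omega> \<in> space M" for \<omega>
    proof (rule bdd_above_mono)
      show "bdd_above (f \<omega> ` {0..1})"
        using cont[OF that]
        by (intro bounded_imp_bdd_above compact_imp_bounded compact_continuous_image) auto
    qed auto
  qed (use assms(1) in auto)
  moreover have "(SUP m\<in>{0..1}. f \<omega> m) = (SUP m\<in>?A. f \<omega> m)" if "\<omega> \<in> space M" for \<omega>
    using SUP_closure_eq[of ?A "f \<omega>"] cont[OF that] ne
    by (simp add: closure_rational_unit_interval)
  ultimately show ?thesis by (simp cong: measurable_cong)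
qed

section \<open>Positivity, continuity and measurability of Kelly wealth\<close>

lemma kelly_bet_factor_ge:
  assumes "\<delta> \<in> {0<..<1}" "m \<in> {0..1}" "y \<in> {0..1}"
  shows "1 + kelly_bet \<kappa> \<delta> a v m * (y - m) \<ge> \<delta>"
  unfolding kelly_bet_def using assms by (rule clipped_factor_ge)

lemma kelly_wealth_pos:
  assumes "\<delta> \<in> {0<..<1}" "m \<in> {0..1}" "\<And>s. s \<ge> 1 \<Longrightarrow> y s \<in> {0..1}"
  shows "wealth (\<lambda>s. kelly_bet \<kappa> \<delta> (a s) (v s) m) y m t > 0"
proof (rule wealth_pos)
  fix s assume "s \<in> {1..t}"
  then show "1 + kelly_bet \<kappa> \<delta> (a s) (v s) m * (y s - m) > 0"
    using kelly_bet_factor_ge[OF assms(1,2), of "y s" \<kappa> "a s" "v s"] assms by auto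
qed

lemma continuous_on_kelly_wealth:
  assumes "\<kappa> > 0" "\<delta> < 1" "\<And>s. v s > 0"
  shows "continuous_on {0..1} (\<lambda>m. wealth (\<lambda>s. kelly_bet \<kappa> \<delta> (a s) (v s) m) y m t)"
proof (induction t)
  case (Suc t)
  have "continuous_on {0..1} (\<lambda>m. kelly_bet \<kappa> \<delta> (a (Suc t)) (v (Suc t)) m)"
    using continuous_on_kelly_bet[OF assms] by simp
  with Suc show ?case by (auto intro!: continuous_intros)
qed simp

lemma borel_measurable_kelly_bet:
  assumes "a \<in> borel_measurable M" "v \<in> borel_measurable M"
  shows "(\<lambda>\<omega>. kelly_bet \<kappa> \<delta> (a \<omega>) (v \<omega>) m) \<in> borel_measurable M"
proof -
  \<comment> \<open>For fixed \<open>m\<close> the conditionals in \<open>clip\<close> are decided,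
    leaving only minima and maxima with constants.\<close>
  have [measurable]: "clip \<delta> m \<in> borel_measurable borel"
    unfolding clip_def Let_def by (cases "m = 0"; cases "m = 1") simp_all
  show ?thesis unfolding kelly_bet_def using assms by measurable
qed

text \<open>Measurability is asked from index 1 on, since the stream is only known to be measurable
  there.\<close>

lemma borel_measurable_wealth:
  assumes "\<And>s. s \<ge> 1 \<Longrightarrow> (\<lambda>\<omega>. b \<omega> s) \<in> borel_measurable M"
    "\<And>s. s \<ge> 1 \<Longrightarrow> (\<lambda>\<omega>. y \<omega> s) \<in> borel_measurable M"
  shows "(\<lambda>\<omega>. wealth (b \<omega>) (y \<omega>) m t) \<in> borel_measurable M"
proof (induction t)
  case (Suc t)
  then show ?case using assms[of "Suc t"] by simp
qed simp

lemma borel_measurable_cum_loglik: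
  assumes "\<And>s. s \<ge> 1 \<Longrightarrow> (\<lambda>\<omega>. y \<omega> s) \<in> borel_measurable M"
  shows "(\<lambda>\<omega>. cum_loglik mu s2 (y \<omega>) k t) \<in> borel_measurable M"
proof (induction t)
  case (Suc t)
  have [measurable]: "(\<lambda>\<omega>. y \<omega> (Suc t)) \<in> borel_measurable M" using assms by simp
  note [measurable] = Suc
  show ?case by simp
qed simp

lemma borel_measurable_sim_weight:
  assumes "\<And>s. s \<ge> 1 \<Longrightarrow> (\<lambda>\<omega>. y \<omega> s) \<in> borel_measurable M"
  shows "(\<lambda>\<omega>. sim_weight \<eta> K mu s2 (y \<omega>) k t) \<in> borel_measurable M"
proof -
  note [measurable] = borel_measurable_cum_loglik[of y, OF assms]
  show ?thesis unfolding sim_weight_def by measurable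
qed

section \<open>Simulator weights\<close>

lemma sim_weight_denom_pos:
  "K \<ge> 1 \<Longrightarrow> (\<Sum>j=1..K. exp (\<eta> * cum_loglik mu s2 y j t)) > 0"
  by (intro sum_pos) auto

lemma sim_weight_pos: "K \<ge> 1 \<Longrightarrow> sim_weight \<eta> K mu s2 y k t > 0"
  unfolding sim_weight_def by (intro divide_pos_pos sim_weight_denom_pos) auto

lemma sum_sim_weight:
  assumes "K \<ge> 1"
  shows "(\<Sum>k=1..K. sim_weight \<eta> K mu s2 y k t) = 1"
  using sim_weight_denom_pos[OF assms, of \<eta> mu s2 y "t - 1"]
  by (simp add: sim_weight_def flip: sum_divide_distrib)

lemma sim_weight_le_1:
  assumes "k \<in> {1..K}"
  shows "sim_weight \<eta> K mu s2 y k t \<le> 1"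
proof -
  from assms have "K \<ge> 1" by auto
  then have "sim_weight \<eta> K mu s2 y k t \<le> (\<Sum>k=1..K. sim_weight \<eta> K mu s2 y k t)"
    using assms by (intro member_le_sum less_imp_le sim_weight_pos) auto
  with sum_sim_weight[OF \<open>K \<ge> 1\<close>] show ?thesis by simp
qed

text \<open>The missing mass is the sum of the other weights, and dividing each by the weight of
  \<open>k'\<close>, which is at most 1, only enlarges it. The ratios no longer contain the
  normaliser, so their expectations can be computed.\<close>

lemma one_minus_sim_weight_le:
  assumes "k' \<in> {1..K}"
  shows "1 - sim_weight \<eta> K mu s2 y k' t \<le> (\<Sum>k\<in>{1..K} - {k'}. weight_ratio \<eta> K mu s2 k' y k t)"
proof -
  let ?w = "\<lambda>k. sim_weight \<eta> K mu s2 y k t"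
  from assms have "K \<ge> 1" by auto
  note pos = sim_weight_pos[OF \<open>K \<ge> 1\<close>]
  have "1 - ?w k' = (\<Sum>k\<in>{1..K} - {k'}. ?w k)"
    using assms sum_sim_weight[OF \<open>K \<ge> 1\<close>, of \<eta> mu s2 y t] by (simp add: sum_diff1)
  also have "\<dots> \<le> (\<Sum>k\<in>{1..K} - {k'}. ?w k / ?w k')"
  proof (rule sum_mono)
    fix k
    show "?w k \<le> ?w k / ?w k'"
      using pos[of \<eta> mu s2 y k' t] pos[of \<eta> mu s2 y k t] sim_weight_le_1[OF assms, of \<eta> mu s2 y t]
      by (simp add: pos_le_divide_eq mult_left_le)
  qed
  finally show ?thesis by (simp add: weight_ratio_def)
qed

text \<open>Relative to \<open>a j\<close> only the mass \<open>1 - w j\<close> on the other points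
  contributes, each at distance at most \<open>D\<close>.\<close>

lemma convex_combination_dist:
  fixes w a :: "'i \<Rightarrow> real"
  assumes "finite I" "j \<in> I" "\<And>i. i \<in> I \<Longrightarrow> w i \<ge> 0" "sum w I = 1"
    "\<And>i. i \<in> I \<Longrightarrow> \<bar>a i - a j\<bar> \<le> D"
  shows "\<bar>(\<Sum>i\<in>I. w i * a i) - c\<bar> \<le> \<bar>a j - c\<bar> + D * (1 - w j)"
proof -
  have "(\<Sum>i\<in>I. w i * a i) - a j = (\<Sum>i\<in>I. w i * (a i - a j))"
    using assms(4) by (simp add: right_diff_distrib sum_subtractf flip: sum_distrib_right)
  also have "\<dots> = (\<Sum>i\<in>I - {j}. w i * (a i - a j))"
    using assms(1,2) by (simp add: sum_diff1)
  also have "\<bar>\<dots>\<bar> \<le> (\<Sum>i\<in>I - {j}. \<bar>w i * (a i - a j)\<bar>)" by (rule sum_abs)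
  also have "\<dots> \<le> (\<Sum>i\<in>I - {j}. w i * D)"
    using assms(3,5) by (intro sum_mono) (auto simp: abs_mult intro: mult_left_mono)
  also have "\<dots> = D * (1 - w j)"
    using assms(1,2,4) by (simp add: sum_diff1 flip: sum_distrib_right)
  finally show ?thesis by linarith
qed

section \<open>Weight ratios as products of independent likelihood ratios\<close>

text \<open>For positive variances this is the Gaussian likelihood ratio of \<open>k\<close> against
  \<open>k'\<close> at \<open>v\<close>, raised to the power \<eta>; the logarithmic form matches
  \<open>cum_loglik\<close>.\<close>

definition lik_ratio :: "real \<Rightarrow> (nat \<Rightarrow> real) \<Rightarrow> (nat \<Rightarrow> real) \<Rightarrow> nat \<Rightarrow> nat \<Rightarrow> real \<Rightarrow> real" where
  "lik_ratio \<eta> mu s2 k' k v =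
    exp (\<eta> * (ln (normal_density (mu k) (sqrt (s2 k)) v) - ln (normal_density (mu k') (sqrt (s2 k')) v)))"

text \<open>The normaliser cancels. The weights of round \<open>Suc t\<close> have seen exactly the
  observations 1 to \<open>t\<close>, hence the shifted index.\<close>

lemma weight_ratio_Suc:
  assumes "K \<ge> 1"
  shows "weight_ratio \<eta> K mu s2 k' y k (Suc t) = (\<Prod>s=1..t. lik_ratio \<eta> mu s2 k' k (y s))"
proof -
  have "weight_ratio \<eta> K mu s2 k' y k (Suc t) =
      exp (\<eta> * (cum_loglik mu s2 y k t - cum_loglik mu s2 y k' t))"
    using sim_weight_denom_pos[OF assms, of \<eta> mu s2 y t]
    by (simp add: weight_ratio_def sim_weight_def exp_diff right_diff_distrib)
  also have "\<dots> = (\<Prod>s=1..t. lik_ratio \<eta> mu s2 k' k (y s))"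
  proof (induction t)
    case (Suc t)
    have "exp (\<eta> * (cum_loglik mu s2 y k (Suc t) - cum_loglik mu s2 y k' (Suc t))) =
        exp (\<eta> * (cum_loglik mu s2 y k t - cum_loglik mu s2 y k' t)) * lik_ratio \<eta> mu s2 k' k (y (Suc t))"
      by (simp add: lik_ratio_def exp_add[symmetric] algebra_simps)
    with Suc.IH show ?case by simp
  qed simp
  finally show ?thesis .
qed

text \<open>Consecutive products differ by one factor, so the growth at \<open>t\<close> depends on
  \<open>y t\<close> alone; the growth hypothesis thus bounds the means of independent
  variables.\<close>

lemma ratio_growth_eq:
  assumes "K \<ge> 1" "t \<ge> 1"
  shows "ratio_growth \<eta> K mu s2 k' y k t = lik_ratio \<eta> mu s2 k' k (y t)"
proof -
  obtain n where t: "t = Suc n" using assms(2) by (cases t) auto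
  have "(\<Prod>s=1..n. lik_ratio \<eta> mu s2 k' k (y s)) \<noteq> 0"
    by (simp add: lik_ratio_def)
  then show ?thesis
    using weight_ratio_Suc[OF assms(1), of \<eta> mu s2 k' y k "Suc n"]
      weight_ratio_Suc[OF assms(1), of \<eta> mu s2 k' y k n]
    by (simp add: ratio_growth_def t)
qed

lemma borel_measurable_lik_ratio [measurable]: "lik_ratio \<eta> mu s2 k' k \<in> borel_measurable borel"
  unfolding lik_ratio_def by measurable

text \<open>A continuous function on a compact interval is bounded. This gives integrability;
  without it a bound on the expectation would say nothing, because the integral of a nonintegrable
  function is 0.\<close>

lemma lik_ratio_bounded:
  assumes "s2 k > 0" "s2 k' > 0"
  obtains B where "\<And>v. v \<in> {0..1} \<Longrightarrow> lik_ratio \<eta> mu s2 k' k v \<le> B"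
proof -
  have cont: "continuous_on {0..1} (normal_density m s)" if "s > 0" for m s
    unfolding normal_density_def using that by (intro continuous_intros) auto
  have "continuous_on {0..1} (lik_ratio \<eta> mu s2 k' k)"
    unfolding lik_ratio_def using assms normal_density_pos
    by (intro continuous_intros cont) (auto simp: less_imp_neq[symmetric] normal_density_pos)
  then have "bounded (lik_ratio \<eta> mu s2 k' k ` {0..1})"
    by (intro compact_imp_bounded compact_continuous_image) auto
  then have "bdd_above (lik_ratio \<eta> mu s2 k' k ` {0..1})"
    by (rule bounded_imp_bdd_above)
  then obtain B where "\<forall>v\<in>{0..1}. lik_ratio \<eta> mu s2 k' k v \<le> B" by (auto simp: bdd_above_def)
  then show ?thesis using that by blast
qed

lemma (in prob_space) expectation_prod_le_power:
  fixes X :: "nat \<Rightarrow> 'a \<Rightarrow> real"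
  assumes "indep_vars (\<lambda>_. borel) X {1..n}"
    "\<And>i. i \<in> {1..n} \<Longrightarrow> integrable M (X i)"
    "\<And>i \<omega>. i \<in> {1..n} \<Longrightarrow> X i \<omega> \<ge> 0"
    "\<And>i. i \<in> {1..n} \<Longrightarrow> expectation (X i) \<le> \<rho>"
  shows "expectation (\<lambda>\<omega>. \<Prod>i=1..n. X i \<omega>) \<le> \<rho> ^ n"
proof -
  have "expectation (\<lambda>\<omega>. \<Prod>i=1..n. X i \<omega>) = (\<Prod>i=1..n. expectation (X i))"
    using assms(1,2) by (intro indep_vars_lebesgue_integral) auto
  also have "\<dots> \<le> (\<Prod>i=1..n. \<rho>)"
    using assms(3,4) by (intro prod_mono) auto
  finally show ?thesis by simp
qed

section \<open>The truncated geometric sum\<close>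

text \<open>The sum is split at the first \<open>n\<close> with
  \<open>c * \<rho> ^ n \<le> 1\<close>. Each earlier term counts at most 1, the later ones are
  dominated by the geometric series, and rounding \<open>n\<close> up accounts for the extra
  1.\<close>

lemma sum_min_geometric_le:
  fixes c \<rho> :: real
  assumes "c \<ge> 1" "\<rho> \<in> {0<..<1}"
  shows "(\<Sum>\<tau>=1..t. min 1 (c * \<rho> ^ (\<tau> - 1))) \<le> 1 + ln c / (- ln \<rho>) + 1 / (1 - \<rho>)"
proof -
  let ?q = "ln c / (- ln \<rho>)"
  define n where "n = nat \<lceil>?q\<rceil>"
  have ln: "ln \<rho> < 0" using assms by simp
  then have q: "?q \<ge> 0" using assms by (intro divide_nonneg_pos) auto
  then have n: "?q \<le> real n" "real n \<le> 1 + ?q"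
    unfolding n_def by linarith+
  have small: "c * \<rho> ^ n \<le> 1"
  proof -
    have "ln c \<le> real n * (- ln \<rho>)" using n(1) ln
      by (subst pos_divide_le_eq[symmetric]) auto
    then have "ln (c * \<rho> ^ n) \<le> 0" using assms by (simp add: ln_mult ln_realpow)
    then show ?thesis using assms by (simp add: ln_le_zero_iff)
  qed
  have "(\<Sum>\<tau>=1..t. min 1 (c * \<rho> ^ (\<tau> - 1))) = (\<Sum>i<t. min 1 (c * \<rho> ^ i))"
    by (rule sum.reindex_bij_witness[of _ Suc "\<lambda>i. i - 1"]) auto
  \<comment> \<open>Adding nonnegative terms up to \<open>n + t\<close> makes the split at
    \<open>n\<close> possible even when \<open>t < n\<close>.\<close>
  also have "\<dots> \<le> (\<Sum>i<n + t. min 1 (c * \<rho> ^ i))"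
    using assms by (intro sum_mono2) auto
  also have "\<dots> = (\<Sum>i<n. min 1 (c * \<rho> ^ i)) + (\<Sum>i<t. min 1 (c * \<rho> ^ (n + i)))"
    by (induction t) (simp_all add: add.assoc)
  also have "\<dots> \<le> (\<Sum>i<n. 1) + (\<Sum>i<t. \<rho> ^ i)"
  proof (intro add_mono sum_mono)
    fix i
    have "c * \<rho> ^ n * \<rho> ^ i \<le> 1 * \<rho> ^ i" using small assms by (intro mult_right_mono) auto
    then show "min 1 (c * \<rho> ^ (n + i)) \<le> \<rho> ^ i" by (simp add: power_add mult.assoc)
  qed simp
  also have "(\<Sum>i<t. \<rho> ^ i) \<le> (\<Sum>i. \<rho> ^ i)"
    using assms by (intro sum_le_suminf summable_geometric) auto
  also have "\<dots> = 1 / (1 - \<rho>)" using assms by (intro suminf_geometric) auto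
  finally show ?thesis using n by simp
qed

section \<open>Mixture moments and the pathwise regret bound\<close>

lemma mix_mean_dist:
  assumes "k' \<in> {1..K}"
  shows "\<bar>mix_mean \<eta> K mu s2 y t - c\<bar> \<le> \<bar>mu k' - c\<bar>
    + (MAX k\<in>{1..K}. \<bar>mu k - mu k'\<bar>) * (1 - sim_weight \<eta> K mu s2 y k' t)"
  unfolding mix_mean_def using assms
  by (intro convex_combination_dist sum_sim_weight less_imp_le[OF sim_weight_pos]) auto

lemma mix_var_dist:
  assumes "k' \<in> {1..K}"
  shows "\<bar>mix_var \<eta> K mu s2 y t - c\<bar> \<le> \<bar>s2 k' - c\<bar>
    + (MAX k\<in>{1..K}. \<bar>s2 k - s2 k'\<bar>) * (1 - sim_weight \<eta> K mu s2 y k' t)"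
  unfolding mix_var_def using assms
  by (intro convex_combination_dist sum_sim_weight less_imp_le[OF sim_weight_pos]) auto

lemma mix_var_ge:
  assumes "K \<ge> 1" "\<And>k. k \<in> {1..K} \<Longrightarrow> s2 k \<ge> c"
  shows "mix_var \<eta> K mu s2 y t \<ge> c"
proof -
  have "c = (\<Sum>k=1..K. sim_weight \<eta> K mu s2 y k t * c)"
    using sum_sim_weight[OF assms(1), of \<eta> mu s2 y t] by (simp flip: sum_distrib_right)
  also have "\<dots> \<le> mix_var \<eta> K mu s2 y t"
    unfolding mix_var_def
    using assms by (intro sum_mono mult_left_mono less_imp_le[OF sim_weight_pos]) auto
  finally show ?thesis .
qed

text \<open>The bound is free of \<open>m\<close>, so it passes to the supremum over candidates. In
  the application \<open>c\<close> is \<open>v_min\<close>.\<close>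

lemma wealth_regret_le:
  assumes "\<delta> \<in> {0<..<1}" "\<kappa> > 0" "c > 0" "k' \<in> {1..K}"
    and "\<And>k. k \<in> {1..K} \<Longrightarrow> s2 k \<ge> c" "var0 \<ge> c"
    and y: "\<And>s. s \<ge> 1 \<Longrightarrow> y s \<in> {0..1}" and m: "m \<in> {0..1}"
  shows "wealth_regret \<eta> \<kappa> \<delta> K mu s2 mu0 var0 y m t \<le>
    (\<Sum>s=1..t. \<kappa> / (\<delta> * c) *
        (\<bar>mu k' - mu0\<bar> + (MAX k\<in>{1..K}. \<bar>mu k - mu k'\<bar>) * (1 - sim_weight \<eta> K mu s2 y k' s))
      + 9 * \<kappa> / (16 * sqrt 3 * \<delta> * c powr (3 / 2)) *
        (\<bar>s2 k' - var0\<bar> + (MAX k\<in>{1..K}. \<bar>s2 k - s2 k'\<bar>) * (1 - sim_weight \<eta> K mu s2 y k' s)))"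
    (is "_ \<le> sum ?b _")
proof -
  let ?m = "mix_mean \<eta> K mu s2 y" and ?v = "mix_var \<eta> K mu s2 y"
  let ?bet = "\<lambda>s. kelly_bet \<kappa> \<delta> (?m s) (?v s) m" and ?ideal = "kelly_bet \<kappa> \<delta> mu0 var0 m"
  from assms have K: "K \<ge> 1" by auto
  have y': "\<bar>y s - m\<bar> \<le> 1" if "s \<in> {1..t}" for s
    using y[of s] m that by (auto simp: abs_le_iff)
  have "wealth_regret \<eta> \<kappa> \<delta> K mu s2 mu0 var0 y m t \<le> (\<Sum>s=1..t. \<bar>?ideal - ?bet s\<bar> / \<delta>)"
    unfolding wealth_regret_def ideal_wealth_def sim_wealth_def
    using assms y' by (intro ln_wealth_diff_le kelly_bet_factor_ge) auto
  also have "\<dots> \<le> sum ?b {1..t}"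
  proof (rule sum_mono)
    fix s
    have "\<bar>?ideal - ?bet s\<bar> \<le> \<kappa> / c * \<bar>?m s - mu0\<bar>
        + 9 * \<kappa> / (16 * sqrt 3 * c powr (3 / 2)) * \<bar>?v s - var0\<bar>"
      using kelly_bet_diff[of \<kappa> c var0 "?v s" \<delta> mu0 m "?m s"] assms mix_var_ge[OF K, of c s2]
      by (simp add: abs_minus_commute)
    also have "\<dots> \<le> \<kappa> / c *
          (\<bar>mu k' - mu0\<bar> + (MAX k\<in>{1..K}. \<bar>mu k - mu k'\<bar>) * (1 - sim_weight \<eta> K mu s2 y k' s))
        + 9 * \<kappa> / (16 * sqrt 3 * c powr (3 / 2)) *
          (\<bar>s2 k' - var0\<bar> + (MAX k\<in>{1..K}. \<bar>s2 k - s2 k'\<bar>) * (1 - sim_weight \<eta> K mu s2 y k' s))"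
      using assms by (intro add_mono mult_left_mono mix_mean_dist mix_var_dist) auto
    finally have "\<bar>?ideal - ?bet s\<bar> / \<delta> \<le> \<dots> / \<delta>"
      using assms by (intro divide_right_mono) auto
    also have "\<dots> = ?b s"
      by (simp add: add_divide_distrib mult.commute mult.left_commute)
    finally show "\<bar>?ideal - ?bet s\<bar> / \<delta> \<le> ?b s" .
  qed
  finally show ?thesis .
qed

lemma continuous_on_wealth_regret:
  assumes "\<delta> \<in> {0<..<1}" "\<kappa> > 0" "K \<ge> 1" "c > 0"
    and "\<And>k. k \<in> {1..K} \<Longrightarrow> s2 k \<ge> c" "var0 > 0"
    and "\<And>s. s \<ge> 1 \<Longrightarrow> y s \<in> {0..1}"
  shows "continuous_on {0..1} (\<lambda>m. wealth_regret \<eta> \<kappa> \<delta> K mu s2 mu0 var0 y m t)"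
proof -
  have v: "mix_var \<eta> K mu s2 y s > 0" for s
    using mix_var_ge[OF \<open>K \<ge> 1\<close>, of c s2] assms(4,5) by (blast intro: less_le_trans)
  have ne: "wealth (\<lambda>s. kelly_bet \<kappa> \<delta> (a s) (u s) m) y m t \<noteq> 0" if "m \<in> {0..1}" for a u m
    using kelly_wealth_pos[of \<delta> m y \<kappa> a u t] assms that by auto
  have "continuous_on {0..1} (\<lambda>m. wealth (\<lambda>s. kelly_bet \<kappa> \<delta> mu0 var0 m) y m t)"
    using continuous_on_kelly_wealth[of \<kappa> \<delta> "\<lambda>_. var0" "\<lambda>_. mu0" y t] assms by auto
  moreover have "continuous_on {0..1} (\<lambda>m. wealth
      (\<lambda>s. kelly_bet \<kappa> \<delta> (mix_mean \<eta> K mu s2 y s) (mix_var \<eta> K mu s2 y s) m) y m t)"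
    using assms v by (intro continuous_on_kelly_wealth) auto
  ultimately show ?thesis
    unfolding wealth_regret_def ideal_wealth_def sim_wealth_def
    using ne ne[of _ "\<lambda>_. mu0" "\<lambda>_. var0"] by (intro continuous_on_diff continuous_on_ln) auto
qed

lemma borel_measurable_wealth_regret:
  assumes "\<And>s. s \<ge> 1 \<Longrightarrow> (\<lambda>\<omega>. y \<omega> s) \<in> borel_measurable M"
  shows "(\<lambda>\<omega>. wealth_regret \<eta> \<kappa> \<delta> K mu s2 mu0 var0 (y \<omega>) m t) \<in> borel_measurable M"
proof -
  note [measurable] = borel_measurable_sim_weight[of y, OF assms]
  have "(\<lambda>\<omega>. mix_mean \<eta> K mu s2 (y \<omega>) s) \<in> borel_measurable M"
    and "(\<lambda>\<omega>. mix_var \<eta> K mu s2 (y \<omega>) s) \<in> borel_measurable M" for s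
    unfolding mix_mean_def mix_var_def by measurable
  then have [measurable]: "(\<lambda>\<omega>. sim_wealth \<eta> \<kappa> \<delta> K mu s2 (y \<omega>) m t) \<in> borel_measurable M"
    unfolding sim_wealth_def
    by (intro borel_measurable_wealth borel_measurable_kelly_bet assms)
  have [measurable]: "(\<lambda>\<omega>. ideal_wealth \<kappa> \<delta> mu0 var0 (y \<omega>) m t) \<in> borel_measurable M"
    unfolding ideal_wealth_def by (intro borel_measurable_wealth assms) auto
  show ?thesis unfolding wealth_regret_def by measurable
qed

text \<open>Boundedness enters because the real supremum of an unbounded set is unspecified.\<close>

lemma worst_regret_nonneg:
  assumes "bdd_above ((\<lambda>m. max (wealth_regret \<eta> \<kappa> \<delta> K mu s2 mu0 var0 y m t) 0) ` {0..1})"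
  shows "worst_regret \<eta> \<kappa> \<delta> K mu s2 mu0 var0 y t \<ge> 0"
  unfolding worst_regret_def by (rule cSUP_upper2[OF assms, of 0]) auto

section \<open>Expected weight away from the reference simulator, and the theorem\<close>

text \<open>Round \<open>Suc t\<close> follows \<open>t\<close> observations, hence the exponent
  \<open>t\<close>. Each of the \<open>K - 1\<close> ratios has mean at most
  \<open>\<rho> ^ t\<close> by independence; the bound 1 holds because weights are positive.\<close>

lemma (in prob_space) expectation_sim_weight_le:
  fixes x :: "nat \<Rightarrow> 'a \<Rightarrow> 'x"
  assumes indep: "indep_vars (\<lambda>_. P) x {1..}"
    and \<psi>: "\<psi> \<in> borel_measurable P" "\<And>a. a \<in> space P \<Longrightarrow> \<psi> a \<in> {0..1}"
    and y: "\<And>\<omega> t. y \<omega> t = \<psi> (x t \<omega>)"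
    and k': "k' \<in> {1..K}" and "\<And>k. k \<in> {1..K} \<Longrightarrow> s2 k > 0"
    and growth: "\<And>k s. k \<in> {1..K} - {k'} \<Longrightarrow> s \<in> {1..t} \<Longrightarrow>
      expectation (\<lambda>\<omega>. ratio_growth \<eta> K mu s2 k' (y \<omega>) k s) \<le> \<rho>"
  shows "expectation (\<lambda>\<omega>. 1 - sim_weight \<eta> K mu s2 (y \<omega>) k' (Suc t)) \<le> min 1 ((real K - 1) * \<rho> ^ t)"
proof -
  from k' have K: "K \<ge> 1" by auto
  have x_meas: "x s \<in> measurable M P" if "s \<ge> 1" for s
    using indep that by (auto simp: indep_vars_def)
  have y_meas: "(\<lambda>\<omega>. y \<omega> s) \<in> borel_measurable M" if "s \<ge> 1" for s
    unfolding y using measurable_compose[OF x_meas[OF that] \<psi>(1)] .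
  have y_range: "y \<omega> s \<in> {0..1}" if "s \<ge> 1" "\<omega> \<in> space M" for s \<omega>
    unfolding y using \<psi>(2) measurable_space[OF x_meas] that by blast
  let ?g = "\<lambda>k s \<omega>. lik_ratio \<eta> mu s2 k' k (y \<omega> s)"
  let ?r = "\<lambda>k \<omega>. weight_ratio \<eta> K mu s2 k' (y \<omega>) k (Suc t)"
  let ?w = "\<lambda>\<omega>. sim_weight \<eta> K mu s2 (y \<omega>) k' (Suc t)"
  have g_int: "integrable M (?g k s)" if k: "k \<in> {1..K}" and s: "s \<in> {1..t}" for k s
  proof -
    obtain B where B: "\<And>v. v \<in> {0..1} \<Longrightarrow> lik_ratio \<eta> mu s2 k' k v \<le> B"
      using lik_ratio_bounded assms(6) k k' by blast
    have "lik_ratio \<eta> mu s2 k' k v \<ge> 0" for v by (simp add: lik_ratio_def)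
    moreover have [measurable]: "(\<lambda>\<omega>. y \<omega> s) \<in> borel_measurable M" using y_meas s by simp
    ultimately show ?thesis
      using B y_range s by (intro integrable_const_bound[of _ B]) auto
  qed
  have g_indep: "indep_vars (\<lambda>_. borel) (?g k) {1..t}" for k
  proof -
    have "indep_vars (\<lambda>_. P) x {1..t}" by (rule indep_vars_subset[OF indep]) auto
    \<comment> \<open>Measurable functions of independent variables are independent, applied to
      \<psi> followed by \<open>lik_ratio\<close>.\<close>
    then show ?thesis
      unfolding y by (rule indep_vars_compose2) (use \<psi>(1) in measurable)
  qed
  have r_eq: "?r k = (\<lambda>\<omega>. \<Prod>s=1..t. ?g k s \<omega>)" for k
    by (rule ext) (rule weight_ratio_Suc[OF K])
  have r_int: "integrable M (?r k)" if "k \<in> {1..K}" for k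
    unfolding r_eq using g_int[OF that] g_indep by (intro indep_vars_integrable) auto
  have r_le: "expectation (?r k) \<le> \<rho> ^ t" if "k \<in> {1..K} - {k'}" for k
  proof -
    have "expectation (?g k s) \<le> \<rho>" if s: "s \<in> {1..t}" for s
      using growth[OF \<open>k \<in> _\<close> s] s by (simp add: ratio_growth_eq[OF K])
    then show ?thesis unfolding r_eq using g_indep g_int that
      by (intro expectation_prod_le_power) (auto simp: lik_ratio_def)
  qed
  have "\<bar>?w \<omega>\<bar> \<le> 1" for \<omega>
    using sim_weight_le_1[OF k'] sim_weight_pos[OF K] by (simp add: less_imp_le)
  then have w_int: "integrable M ?w"
    using borel_measurable_sim_weight[of y, OF y_meas] by (intro integrable_const_bound[of _ 1]) auto
  have "expectation (\<lambda>\<omega>. 1 - ?w \<omega>) \<le> expectation (\<lambda>\<omega>. \<Sum>k\<in>{1..K} - {k'}. ?r k \<omega>)"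
    using w_int r_int one_minus_sim_weight_le[OF k'] by (intro integral_mono) auto
  also have "\<dots> = (\<Sum>k\<in>{1..K} - {k'}. expectation (?r k))"
    using r_int by (intro Bochner_Integration.integral_sum) auto
  also have "\<dots> \<le> (\<Sum>k\<in>{1..K} - {k'}. \<rho> ^ t)" by (intro sum_mono r_le)
  also have "\<dots> = (real K - 1) * \<rho> ^ t" using k' K by (simp add: of_nat_diff)
  finally have "expectation (\<lambda>\<omega>. 1 - ?w \<omega>) \<le> (real K - 1) * \<rho> ^ t" .
  moreover have "expectation (\<lambda>\<omega>. 1 - ?w \<omega>) \<le> expectation (\<lambda>_. 1)"
    using w_int less_imp_le[OF sim_weight_pos[OF K]] by (intro integral_mono) auto
  ultimately show ?thesis by (simp add: prob_space)
qed

text \<open>Integrability is part of the conclusion because the default integral 0 of a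
  nonintegrable function would make the bound on the expectation hold for the wrong reason.\<close>

theorem theorem2:
  fixes \<Omega> :: "'w measure" and P :: "'x measure"
    and x :: "nat \<Rightarrow> 'w \<Rightarrow> 'x" and \<psi> :: "'x \<Rightarrow> real" and y :: "'w \<Rightarrow> nat \<Rightarrow> real"
    and mu0 var0 :: real
    and K T k' :: nat and mu s2 :: "nat \<Rightarrow> real"
    and \<eta> \<kappa> \<delta> \<rho> :: real
    and v_min a_m a_v h_m h_v D_m D_v :: real and S :: "nat \<Rightarrow> real"
  assumes "prob_space \<Omega>" and "prob_space P"
    and indep: "prob_space.indep_vars \<Omega> (\<lambda>_. P) x {1..}"
    and distr: "\<And>t. t \<ge> 1 \<Longrightarrow> distr \<Omega> P (x t) = P"
    and \<psi>_meas: "\<psi> \<in> borel_measurable P"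
    and \<psi>_range: "\<And>a. a \<in> space P \<Longrightarrow> \<psi> a \<in> {0..1}"
    and y: "\<And>\<omega> t. y \<omega> t = \<psi> (x t \<omega>)"
    and mean: "\<And>t. t \<ge> 1 \<Longrightarrow> mu0 = (\<integral>\<omega>. y \<omega> t \<partial>\<Omega>)"
    and variance: "\<And>t. t \<ge> 1 \<Longrightarrow> var0 = (\<integral>\<omega>. (y \<omega> t - mu0)\<^sup>2 \<partial>\<Omega>)"
    and var_pos: "var0 > 0"
    and K: "K \<ge> 2"
    and bank_mean: "\<And>k. k \<in> {1..K} \<Longrightarrow> mu k \<in> {0..1}"
    and bank_var: "\<And>k. k \<in> {1..K} \<Longrightarrow> s2 k > 0"
    and \<eta>: "\<eta> > 0" and \<kappa>: "\<kappa> \<in> {0<..1}" and \<delta>: "\<delta> \<in> {0<..<1}"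
    and k': "k' \<in> {1..K}"
    and \<rho>: "\<rho> \<in> {0<..<1}"
    and growth: "\<And>k t. k \<in> {1..K} - {k'} \<Longrightarrow> t \<in> {1..T - 1} \<Longrightarrow>
      (\<integral>\<omega>. ratio_growth \<eta> K mu s2 k' (y \<omega>) k t \<partial>\<Omega>) \<le> \<rho>"
    and v_min: "v_min = Min (insert var0 (s2 ` {1..K}))"
    and a_m: "a_m = \<kappa> / (\<delta> * v_min)"
    and a_v: "a_v = 9 * \<kappa> / (16 * sqrt 3 * \<delta> * v_min powr (3 / 2))"
    and h_m: "h_m = \<bar>mu k' - mu0\<bar>"
    and h_v: "h_v = \<bar>s2 k' - var0\<bar>"
    and D_m: "D_m = (MAX k\<in>{1..K}. \<bar>mu k - mu k'\<bar>)"
    and D_v: "D_v = (MAX k\<in>{1..K}. \<bar>s2 k - s2 k'\<bar>)"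
    and S: "\<And>t. S t = (\<Sum>\<tau>=1..t. min 1 ((real K - 1) * \<rho> ^ (\<tau> - 1)))"
  shows "\<forall>t\<in>{1..T}.
      S t \<le> 1 + ln (real K - 1) / (- ln \<rho>) + 1 / (1 - \<rho>) \<and>
      integrable \<Omega> (\<lambda>\<omega>. worst_regret \<eta> \<kappa> \<delta> K mu s2 mu0 var0 (y \<omega>) t) \<and>
      (\<integral>\<omega>. worst_regret \<eta> \<kappa> \<delta> K mu s2 mu0 var0 (y \<omega>) t \<partial>\<Omega>) / real t
        \<le> a_m * (h_m + D_m * S t / real t) + a_v * (h_v + D_v * S t / real t)"
proof
  fix t assume t: "t \<in> {1..T}"
  interpret prob_space \<Omega> by fact
  from K have K1: "K \<ge> 1" by simp
  have x_meas: "x s \<in> measurable \<Omega> P" if "s \<ge> 1" for s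
    using indep that by (auto simp: indep_vars_def)
  have y_meas: "(\<lambda>\<omega>. y \<omega> s) \<in> borel_measurable \<Omega>" if "s \<ge> 1" for s
    unfolding y using measurable_compose[OF x_meas[OF that] \<psi>_meas] .
  have y_range: "y \<omega> s \<in> {0..1}" if "\<omega> \<in> space \<Omega>" "s \<ge> 1" for s \<omega>
    unfolding y using \<psi>_range measurable_space[OF x_meas] that by blast
  have v_pos: "v_min > 0" using var_pos bank_var by (simp add: v_min)
  have v_le: "v_min \<le> var0" "\<And>k. k \<in> {1..K} \<Longrightarrow> v_min \<le> s2 k" unfolding v_min by (rule Min_le; simp)+
  have coeffs: "a_m \<ge> 0" "a_v \<ge> 0" "h_m \<ge> 0" "h_v \<ge> 0"
    using \<kappa> \<delta> v_pos by (auto simp: a_m a_v h_m h_v)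
  \<comment> \<open>The index \<open>k'\<close> itself contributes the value 0 to each
    maximum.\<close>
  have D: "D_m \<ge> 0" "D_v \<ge> 0"
    using Max_ge[of "(\<lambda>k. \<bar>mu k - mu k'\<bar>) ` {1..K}" 0] Max_ge[of "(\<lambda>k. \<bar>s2 k - s2 k'\<bar>) ` {1..K}" 0] k'
    by (force simp: D_m D_v)+
  let ?R = "\<lambda>\<omega> m. max (wealth_regret \<eta> \<kappa> \<delta> K mu s2 mu0 var0 (y \<omega>) m t) 0"
  let ?W = "\<lambda>\<omega>. worst_regret \<eta> \<kappa> \<delta> K mu s2 mu0 var0 (y \<omega>) t"
  let ?u = "\<lambda>s \<omega>. 1 - sim_weight \<eta> K mu s2 (y \<omega>) k' s"
  let ?b = "\<lambda>s \<omega>. a_m * (h_m + D_m * ?u s \<omega>) + a_v * (h_v + D_v * ?u s \<omega>)"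
  have u: "?u s \<omega> \<ge> 0" "?u s \<omega> \<le> 1" for s \<omega>
    using sim_weight_le_1[OF k'] sim_weight_pos[OF K1] by (simp_all add: less_imp_le)
  have b_nonneg: "?b s \<omega> \<ge> 0" for s \<omega>
    using coeffs D u by simp
  have R_le: "?R \<omega> m \<le> (\<Sum>s=1..t. ?b s \<omega>)" if "\<omega> \<in> space \<Omega>" "m \<in> {0..1}" for \<omega> m
  proof (rule max.boundedI)
    show "wealth_regret \<eta> \<kappa> \<delta> K mu s2 mu0 var0 (y \<omega>) m t \<le> (\<Sum>s=1..t. ?b s \<omega>)"
      unfolding a_m a_v h_m h_v D_m D_v
      using \<delta> \<kappa> v_pos k' v_le y_range that by (intro wealth_regret_le) auto
  qed (rule sum_nonneg[OF b_nonneg])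
  have W_le: "?W \<omega> \<le> (\<Sum>s=1..t. ?b s \<omega>)" if "\<omega> \<in> space \<Omega>" for \<omega>
    unfolding worst_regret_def using R_le[OF that] by (intro cSUP_least) auto
  \<comment> \<open>\<open>R_le\<close> supplies the boundedness over \<open>m\<close> that makes
    the supremum meaningful.\<close>
  have W_nonneg: "?W \<omega> \<ge> 0" if "\<omega> \<in> space \<Omega>" for \<omega>
    using R_le[OF that] by (intro worst_regret_nonneg) (auto simp only: intro!: bdd_aboveI2)
  have W_meas: "?W \<in> borel_measurable \<Omega>"
    unfolding worst_regret_def
  proof (rule borel_measurable_SUP_unit_interval)
    show "(\<lambda>\<omega>. ?R \<omega> m) \<in> borel_measurable \<Omega>" for m
      using borel_measurable_wealth_regret[of y, OF y_meas] by (intro borel_measurable_max) auto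
    show "continuous_on {0..1} (?R \<omega>)" if "\<omega> \<in> space \<Omega>" for \<omega>
      using \<delta> \<kappa> K1 v_pos v_le var_pos y_range[OF that]
      by (intro continuous_on_max continuous_on_wealth_regret[of _ _ _ v_min] continuous_on_const) auto
  qed
  have u_int: "integrable \<Omega> (?u s)" for s
    using borel_measurable_sim_weight[of y, OF y_meas] u
    by (intro integrable_const_bound[of _ 1]) auto
  have b_int: "integrable \<Omega> (?b s)" for s
    using u_int by (intro Bochner_Integration.integrable_add integrable_mult_right integrable_const)
  \<comment> \<open>The worst regret is measurable and lies between 0 and an integrable sum.\<close>
  have W_int: "integrable \<Omega> ?W"
  proof (rule Bochner_Integration.integrable_bound)
    show "integrable \<Omega> (\<lambda>\<omega>. \<Sum>s=1..t. ?b s \<omega>)"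
      by (rule Bochner_Integration.integrable_sum) (rule b_int)
    show "AE \<omega> in \<Omega>. norm (?W \<omega>) \<le> norm (\<Sum>s=1..t. ?b s \<omega>)"
    proof (rule AE_I2)
      fix \<omega> assume "\<omega> \<in> space \<Omega>"
      from W_le[OF this] W_nonneg[OF this] show "norm (?W \<omega>) \<le> norm (\<Sum>s=1..t. ?b s \<omega>)"
        unfolding real_norm_def by linarith
    qed
  qed (rule W_meas)
  have u_le: "expectation (?u s) \<le> min 1 ((real K - 1) * \<rho> ^ (s - 1))" if s: "s \<in> {1..t}" for s
  proof -
    have "expectation (?u (Suc (s - 1))) \<le> min 1 ((real K - 1) * \<rho> ^ (s - 1))"
      using indep \<psi>_meas \<psi>_range y k' bank_var
    proof (rule expectation_sim_weight_le)
      fix k r assume k: "k \<in> {1..K} - {k'}" and "r \<in> {1..s - 1}"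
      \<comment> \<open>The weight of round \<open>s\<close> uses growth factors up to
        \<open>s - 1\<close> only, so the growth hypothesis up to \<open>T - 1\<close> covers every
        \<open>s \<le> T\<close>.\<close>
      then have "r \<in> {1..T - 1}" using s t by auto
      with k show "expectation (\<lambda>\<omega>. ratio_growth \<eta> K mu s2 k' (y \<omega>) k r) \<le> \<rho>" by (rule growth)
    qed
    moreover have "Suc (s - 1) = s" using s by simp
    ultimately show ?thesis by (simp only:)
  qed
  have "expectation ?W \<le> expectation (\<lambda>\<omega>. \<Sum>s=1..t. ?b s \<omega>)"
    using W_int b_int W_le by (intro integral_mono) auto
  \<comment> \<open>Each summand is affine in the missing weight, so the expectation moves
    inside.\<close>
  also have "\<dots> = (\<Sum>s=1..t. a_m * (h_m + D_m * expectation (?u s)) + a_v * (h_v + D_v * expectation (?u s)))"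
    using b_int u_int by (simp add: prob_space)
  also have "\<dots> \<le> (\<Sum>s=1..t. a_m * (h_m + D_m * min 1 ((real K - 1) * \<rho> ^ (s - 1)))
      + a_v * (h_v + D_v * min 1 ((real K - 1) * \<rho> ^ (s - 1))))"
    using coeffs D u_le by (intro sum_mono add_mono mult_left_mono) auto
  also have "\<dots> = a_m * (real t * h_m + D_m * S t) + a_v * (real t * h_v + D_v * S t)"
    by (simp add: S sum.distrib flip: sum_distrib_left)
  finally have "expectation ?W / real t \<le>
      (a_m * (real t * h_m + D_m * S t) + a_v * (real t * h_v + D_v * S t)) / real t"
    using t by (intro divide_right_mono) auto
  also have "\<dots> = a_m * (h_m + D_m * S t / real t) + a_v * (h_v + D_v * S t / real t)"
    using t by (simp add: field_simps)
  finally show "S t \<le> 1 + ln (real K - 1) / (- ln \<rho>) + 1 / (1 - \<rho>) \<and> integrable \<Omega> ?W \<and>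
      expectation ?W / real t \<le> a_m * (h_m + D_m * S t / real t) + a_v * (h_v + D_v * S t / real t)"
    using sum_min_geometric_le[of "real K - 1" \<rho> t] K \<rho> W_int by (simp add: S)
qed

end
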